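(* Let $\Bbbk$ be a field, $S=\Bbbk[x_1,\dots,x_n]$, let $I \subsetneq S$ be a squarefree monomial ideal with minimal free resolution $\mathbb{F}$ of $S/I$, and let $*$ be a multiplication on $\mathbb{F}$. Then every homogeneous element $f \in \mathbb{F}$ of squarefree degree with $|f| \geq 1$ can be written as a finite sum $$f = \sum_j \bigl|g_{1,j} * (g_{2,j} * (\cdots (g_{|f|-1,j} * g_{|f|,j}) \cdots ))\bigr|_{\mathrm{sqf}},$$ for homogeneous elements $g_{\ell,j} \in \mathbb{F}_1$, for $1 \leq \ell \leq |f|$ and all $j$.
   Context: $S$ carries the fine $\mathbb{Z}^n$-grading. Let $\mathbb{F}$ be the minimal $\mathbb{Z}^n$-graded free resolution of $S/I$ with $\mathbb{F}_0=S$ and differential $\partial$, identified with $\bigoplus_i\mathbb{F}_i$; $|f|$ denotes the homological degree and $\deg f$ the multidegree. Homogeneous means homogeneous for both the homological grading and the multigrading; a degree in $\mathbb{N}^n$ is squarefree if it is componentwise $\le(1,\dots,1)$. A multiplication on $\mathbb{F}$ is an $S$-linear map $*:\mathbb{F}\otimes_S\mathbb{F}\to\mathbb{F}$ respecting the $\mathbb{Z}^n$-grading (not necessarily associative), such that for all (homogeneous) $a,b$: (1) $*$ extends the usual multiplication on $\mathbb{F}_0=S$ and $1\in\mathbb{F}_0$ acts as the identity; (2) $\partial(a*b)=\partial(a)*b+(-1)^{|a|}a*\partial(b)$; (3) $|a*b|=|a|+|b|$; (4) $a*b=(-1)^{|a||b|}b*a$. Squarefree part: since $I$ is squarefree, all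 basis elements of $\mathbb{F}$ have squarefree degree, and every homogeneous $f\in\mathbb{F}$ can be written uniquely as $f=mf'$ with $m\in S$ a monomial and $f'\in\mathbb{F}$ with $\deg f'=(\deg f)\wedge(1,\dots,1)$, where $\wedge$ is the componentwise minimum. The element $f'$ is the squarefree part of $f$ and is denoted $|f|_{\mathrm{sqf}}$ (with $|0|_{\mathrm{sqf}}=0$). *)

theory Defs
  imports "HOL-Library.Poly_Mapping" HOL.Modules
begin

text \<open>
  The polynomial ring over \<^typ>\<open>'k\<close> in variables indexed by \<^typ>\<open>'n\<close>: finitely supported functions
  from exponent vectors to coefficients, with the convolution product.
\<close>

type_synonym ('n, 'k) mpoly = "('n \<Rightarrow>\<^sub>0 nat) \<Rightarrow>\<^sub>0 'k"

type_synonym 'n mdegree = "'n \<Rightarrow> int"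

definition monom :: "('n \<Rightarrow>\<^sub>0 nat) \<Rightarrow> ('n, 'k::field) mpoly"
  where "monom e = Poly_Mapping.single e 1"

definition var :: "'n \<Rightarrow> ('n, 'k::field) mpoly"
  where "var i = monom (Poly_Mapping.single i 1)"

definition mdegree_of_exp :: "('n \<Rightarrow>\<^sub>0 nat) \<Rightarrow> 'n mdegree"
  where "mdegree_of_exp e = (\<lambda>i. int (Poly_Mapping.lookup e i))"

definition add_mdegree :: "'n mdegree \<Rightarrow> 'n mdegree \<Rightarrow> 'n mdegree"
  where "add_mdegree \<alpha> \<beta> = (\<lambda>i. \<alpha> i + \<beta> i)"

definition squarefree_mdegree :: "'n mdegree \<Rightarrow> bool"
  where "squarefree_mdegree \<alpha> \<longleftrightarrow> (\<forall>i. 0 \<le> \<alpha> i \<and> \<alpha> i \<le> 1)"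

text \<open>
  The locale \<^locale>\<open>module\<close> applied to the multiplication of a commutative ring: submodules are ideals
  and the span of a set is the ideal it generates.
\<close>

definition squarefree_monomial_ideal :: "('n, 'k::field) mpoly set \<Rightarrow> bool"
  where "squarefree_monomial_ideal I \<longleftrightarrow>
    (\<exists>E. (\<forall>e\<in>E. squarefree_mdegree (mdegree_of_exp e)) \<and> I = module.span (*) (monom ` E))"

text \<open>
  The free modules \<open>F\<^sub>i\<close> are collected in one module, the whole type \<^typ>\<open>'m\<close>, and
  \<open>comp i \<alpha>\<close> is the set of elements of homological degree \<open>i\<close> and multidegree \<open>\<alpha>\<close>, including zero.
\<close>

locale multigraded_module = module scale
  for scale :: "('n::finite, 'k::field) mpoly \<Rightarrow> 'm::ab_group_add \<Rightarrow> 'm" +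
  fixes comp :: "nat \<Rightarrow> 'n mdegree \<Rightarrow> 'm set"
  assumes comp_zero: "0 \<in> comp i \<alpha>"
    and comp_add: "f \<in> comp i \<alpha> \<Longrightarrow> g \<in> comp i \<alpha> \<Longrightarrow> f + g \<in> comp i \<alpha>"
    and comp_scale: "f \<in> comp i \<alpha> \<Longrightarrow>
      scale (Poly_Mapping.single e c) f \<in> comp i (add_mdegree (mdegree_of_exp e) \<alpha>)"
    and comp_direct_sum: "\<exists>!h. finite {q. h q \<noteq> 0} \<and> (\<forall>i \<alpha>. h (i, \<alpha>) \<in> comp i \<alpha>) \<and>
      f = (\<Sum>q | h q \<noteq> 0. h q)"
begin

definition hpart :: "nat \<Rightarrow> 'm set"
  where "hpart i = span (\<Union>\<alpha>. comp i \<alpha>)"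

text \<open>
  The condition \<open>f = 0\<close> is separate because zero has no well-defined degree. For \<open>f \<noteq> 0\<close> the
  degrees \<open>i\<close> and \<open>\<alpha>\<close> are determined by \<open>f\<close>.
\<close>

definition sqf_part :: "'m \<Rightarrow> 'm"
  where "sqf_part f = (if f = 0 then 0 else
    (THE f'. \<exists>i \<alpha> e. f \<in> comp i \<alpha> \<and> f' \<in> comp i (\<lambda>v. min (\<alpha> v) 1) \<and> f = scale (monom e) f'))"

end

text \<open>
  The element \<open>one\<close> fixes the identification of \<open>S\<close> with \<open>F\<^sub>0\<close>, namely \<open>s \<mapsto> scale s one\<close>. Under it,
  exactness of \<open>F\<^sub>1 \<rightarrow> F\<^sub>0 \<rightarrow> S/I \<rightarrow> 0\<close> says that the image of \<open>F\<^sub>1\<close> is \<open>I\<close>. Minimality is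
  \<open>\<delta>(F) \<subseteq> (x\<^sub>1, \<dots>, x\<^sub>n) F\<close>.
\<close>

locale minimal_free_resolution = multigraded_module scale comp
  for scale :: "('n::finite, 'k::field) mpoly \<Rightarrow> 'm::ab_group_add \<Rightarrow> 'm"
    and comp :: "nat \<Rightarrow> 'n mdegree \<Rightarrow> 'm set" +
  fixes \<delta> :: "'m \<Rightarrow> 'm"
    and one :: 'm
    and I :: "('n, 'k) mpoly set"
  assumes homogeneous_basis: "\<exists>B. B \<subseteq> (\<Union>i \<alpha>. comp i \<alpha>) \<and> independent B \<and> span B = UNIV"
    and one_comp: "one \<in> comp 0 (\<lambda>_. 0)"
    and F0_eq_S: "bij_betw (\<lambda>s. scale s one) UNIV (hpart 0)"
    and \<delta>_linear: "module_hom scale scale \<delta>"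
    and \<delta>_comp: "\<delta> ` comp (Suc i) \<alpha> \<subseteq> comp i \<alpha>"
    and \<delta>_F0: "f \<in> hpart 0 \<Longrightarrow> \<delta> f = 0"
    and exact_0: "\<delta> ` hpart 1 = (\<lambda>s. scale s one) ` I"
    and exact_Suc: "\<delta> ` hpart (Suc (Suc i)) = {f \<in> hpart (Suc i). \<delta> f = 0}"
    and minimal: "range \<delta> \<subseteq> span {scale (var v) f | v f. True}"

locale resolution_multiplication = minimal_free_resolution scale comp \<delta> one I
  for scale :: "('n::finite, 'k::field) mpoly \<Rightarrow> 'm::ab_group_add \<Rightarrow> 'm"
    and comp :: "nat \<Rightarrow> 'n mdegree \<Rightarrow> 'm set"
    and \<delta> :: "'m \<Rightarrow> 'm"
    and one :: 'm
    and I :: "('n, 'k) mpoly set" +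
  fixes mult :: "'m \<Rightarrow> 'm \<Rightarrow> 'm"
  assumes mult_linear_right: "module_hom scale scale (mult a)"
    and mult_linear_left: "module_hom scale scale (\<lambda>a. mult a b)"
    and mult_comp: "a \<in> comp i \<alpha> \<Longrightarrow> b \<in> comp j \<beta> \<Longrightarrow> mult a b \<in> comp (i + j) (add_mdegree \<alpha> \<beta>)"
    and mult_S: "mult (scale s one) (scale t one) = scale (s * t) one"
    and mult_one_left: "mult one f = f"
    and mult_one_right: "mult f one = f"
    and leibniz: "a \<in> comp i \<alpha> \<Longrightarrow> b \<in> comp j \<beta> \<Longrightarrow>
      \<delta> (mult a b) = mult (\<delta> a) b + scale ((-1) ^ i) (mult a (\<delta> b))"
    and graded_commutative: "a \<in> comp i \<alpha> \<Longrightarrow> b \<in> comp j \<beta> \<Longrightarrow>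
      mult a b = scale ((-1) ^ (i * j)) (mult b a)"

text \<open>The product \<open>g\<^sub>1 * (g\<^sub>2 * (\<cdots> (g\<^sub>p\<^sub>-\<^sub>1 * g\<^sub>p) \<cdots>))\<close>; the empty list does not occur.\<close>

fun right_nested :: "('m \<Rightarrow> 'm \<Rightarrow> 'm) \<Rightarrow> 'm list \<Rightarrow> 'm" where
  "right_nested m [g] = g"
| "right_nested m (g # g' # gs) = m g (right_nested m (g' # gs))"
| "right_nested m [] = undefined"

end

theory Submission
  imports Defs
begin

text \<open>
  Let \<open>f\<close> have squarefree degree \<open>\<alpha>\<close> and homological degree \<open>p \<ge> 2\<close>. If \<open>f \<noteq> 0\<close>, there is a monomial
  \<open>x\<^sup>e \<in> I\<close> that divides \<open>x\<^sup>\<alpha>\<close> (\<open>monom_in_ideal_below\<close>), and it is \<open>\<delta> g\<close> for some homogeneous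
  \<open>g \<in> F\<^sub>1\<close>. The Leibniz rule gives \<open>x\<^sup>e f = \<delta> (g * f) + g * \<delta> f\<close>, and after cancellation of \<open>x\<^sup>e\<close>
  it becomes \<open>f = \<delta> h + |g * \<delta> f|\<^sub>s\<^sub>q\<^sub>f\<close> with \<open>h = |g * f|\<^sub>s\<^sub>q\<^sub>f\<close> (\<open>sqf_part_homotopy\<close>). By induction
  on \<open>p\<close>, \<open>\<delta> f\<close> is a sum of squarefree parts \<open>|w|\<^sub>s\<^sub>q\<^sub>f\<close> of products \<open>w\<close> of
  \<open>p - 1\<close> elements of \<open>F\<^sub>1\<close>, and \<open>|g * |w|\<^sub>s\<^sub>q\<^sub>f|\<^sub>s\<^sub>q\<^sub>f = |g * w|\<^sub>s\<^sub>q\<^sub>f\<close> (\<open>product_parts_mult\<close>).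
  By minimality \<open>\<delta> h = \<Sum>\<^sub>v x\<^sub>v u\<^sub>v\<close> with \<open>u\<^sub>v\<close> of homological degree \<open>p\<close> and
  smaller multidegree, which is handled by a second induction, since \<open>x\<^sub>v\<close> can be moved into the
  first factor of a product (\<open>product_parts_var\<close>). For \<open>p = 1\<close>, \<open>f\<close> is its own squarefree part.

  All this uses the existence of squarefree parts, which follows from the degrees of a homogeneous
  basis of the resolution being squarefree (\<open>basis_squarefree\<close>). This is proved by
  induction along the resolution: kernels of maps between free modules with squarefree generators
  are again generated in squarefree degrees, and by minimality a basis of the next module needs
  no other degrees.
\<close>

section \<open>Monomials and multidegrees\<close>

lemma mpoly_induct [case_names zero add single]:
  fixes s :: "('n, 'k::field) mpoly"
  assumes zero: "P 0"
    and add: "\<And>s t. P s \<Longrightarrow> P t \<Longrightarrow> P (s + t)"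
    and single: "\<And>e c. P (Poly_Mapping.single e c)"
  shows "P s"
proof (induction s rule: update_induct)
  case const
  show ?case by (rule zero)
next
  case (update f a b)
  have "Poly_Mapping.update a b f = Poly_Mapping.single a b + f"
    using update(1)
    by (intro poly_mapping_eqI) (auto simp: lookup_add lookup_update lookup_single when_def in_keys_iff)
  then show ?case using add[OF single update(3)] by simp
qed

lemma lookup_single_times_shift:
  fixes s :: "('n, 'k::field) mpoly"
  shows "Poly_Mapping.lookup (Poly_Mapping.single e c * s) (e + d) = c * Poly_Mapping.lookup s d"
  by (induction s rule: mpoly_induct)
    (auto simp: lookup_add distrib_left mult_single lookup_single when_def)

lemma lookup_single_times_nonzeroE:
  fixes s :: "('n, 'k::field) mpoly"
  assumes "Poly_Mapping.lookup (Poly_Mapping.single e c * s) d \<noteq> 0"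
  obtains r where "d = e + r"
proof -
  have "Poly_Mapping.lookup (Poly_Mapping.single e c * s) d \<noteq> 0 \<longrightarrow> (\<exists>r. d = e + r)"
    by (induction s rule: mpoly_induct)
      (auto simp: lookup_add distrib_left mult_single lookup_single when_def)
  then show thesis using assms that by blast
qed

lemma monom_times_eq_0_iff:
  fixes s :: "('n, 'k::field) mpoly"
  shows "monom e * s = 0 \<longleftrightarrow> s = 0"
proof
  assume "monom e * s = 0"
  then have "Poly_Mapping.lookup s d = 0" for d
    using lookup_single_times_shift[of e 1 s d] by (simp add: monom_def)
  then show "s = 0" by (intro poly_mapping_eqI) simp
qed simp

lemma lookup_var_times_0:
  fixes s :: "('n, 'k::field) mpoly"
  shows "Poly_Mapping.lookup (var v * s) 0 = 0"
proof (rule ccontr)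
  assume "Poly_Mapping.lookup (var v * s) 0 \<noteq> 0"
  then obtain r where "0 = Poly_Mapping.single v (1::nat) + r"
    unfolding var_def monom_def by (rule lookup_single_times_nonzeroE)
  then have "Poly_Mapping.lookup (0 :: 'n \<Rightarrow>\<^sub>0 nat) v = Poly_Mapping.lookup (Poly_Mapping.single v (1::nat) + r) v" by simp
  then show False by (simp add: lookup_add)
qed

lemma monom_mult: "monom d * monom e = (monom (d + e) :: ('n, 'k::field) mpoly)"
  by (simp add: monom_def mult_single)

definition exp_of :: "('n::finite \<Rightarrow> int) \<Rightarrow> ('n \<Rightarrow>\<^sub>0 nat)"
  where "exp_of \<gamma> = Abs_poly_mapping (\<lambda>v. nat (\<gamma> v))"

lemma lookup_exp_of [simp]: "Poly_Mapping.lookup (exp_of \<gamma>) v = nat (\<gamma> v)"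
  unfolding exp_of_def by (subst Abs_poly_mapping_inverse) simp_all

lemma mdegree_of_exp_inject: "mdegree_of_exp d = mdegree_of_exp e \<longleftrightarrow> d = e"
  by (auto simp: mdegree_of_exp_def fun_eq_iff intro!: poly_mapping_eqI)

lemma mdegree_of_exp_nonneg: "0 \<le> mdegree_of_exp e v"
  by (simp add: mdegree_of_exp_def)

lemma mdegree_of_exp_plus:
  "mdegree_of_exp (d + e) = add_mdegree (mdegree_of_exp d) (mdegree_of_exp e)"
  by (simp add: mdegree_of_exp_def add_mdegree_def lookup_add)

lemma mdegree_of_exp_0: "mdegree_of_exp 0 = (\<lambda>_. 0)"
  by (simp add: mdegree_of_exp_def)

lemma mdegree_of_exp_exp_of: "(\<And>v. 0 \<le> \<gamma> v) \<Longrightarrow> mdegree_of_exp (exp_of \<gamma>) = \<gamma>"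
  by (simp add: mdegree_of_exp_def fun_eq_iff)

lemma mdegree_of_exp_single:
  "mdegree_of_exp (Poly_Mapping.single v 1) = (\<lambda>w. if w = v then 1 else 0)"
  by (auto simp: mdegree_of_exp_def lookup_single fun_eq_iff when_def)

lemma add_mdegree_0_right [simp]: "add_mdegree \<gamma> (\<lambda>_. 0) = \<gamma>"
  by (simp add: add_mdegree_def)

lemma add_mdegree_assoc:
  "add_mdegree (add_mdegree \<alpha> \<beta>) \<gamma> = add_mdegree \<alpha> (add_mdegree \<beta> \<gamma>)"
  by (simp add: add_mdegree_def add.assoc)

lemma add_mdegree_left_cancel: "add_mdegree \<alpha> \<beta> = add_mdegree \<alpha> \<gamma> \<longleftrightarrow> \<beta> = \<gamma>"
  by (simp add: add_mdegree_def fun_eq_iff)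

definition lower :: "'n \<Rightarrow> 'n mdegree \<Rightarrow> 'n mdegree"
  where "lower v \<gamma> = \<gamma>(v := \<gamma> v - 1)"

lemma add_mdegree_var_lower:
  "add_mdegree (mdegree_of_exp (Poly_Mapping.single v 1)) (lower v \<gamma>) = \<gamma>"
  by (auto simp: lower_def mdegree_of_exp_single add_mdegree_def fun_eq_iff simp del: One_nat_def)

lemma sum_lower:
  fixes \<gamma> :: "'n::finite mdegree"
  shows "sum (lower v \<gamma>) UNIV = sum \<gamma> UNIV - 1"
  by (simp add: lower_def sum.remove[OF finite UNIV_I, of _ v])

definition cap :: "'n mdegree \<Rightarrow> 'n mdegree"
  where "cap \<gamma> = (\<lambda>v. min (\<gamma> v) 1)"

definition excess :: "'n::finite mdegree \<Rightarrow> ('n \<Rightarrow>\<^sub>0 nat)"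
  where "excess \<gamma> = exp_of (\<lambda>v. \<gamma> v - cap \<gamma> v)"

lemma excess_plus_cap: "add_mdegree (mdegree_of_exp (excess \<gamma>)) (cap \<gamma>) = \<gamma>"
  by (simp add: excess_def cap_def mdegree_of_exp_def add_mdegree_def fun_eq_iff)

lemma cap_squarefree: "squarefree_mdegree \<gamma> \<Longrightarrow> cap \<gamma> = \<gamma>"
  by (auto simp: squarefree_mdegree_def cap_def min_def fun_eq_iff antisym)

text \<open>
  Every term of \<open>s * x\<^sup>e\<close> is divisible by \<open>x\<^sup>e\<close>, so every monomial occurring in an element of \<open>I\<close> is
  divisible by a squarefree generator \<open>x\<^sup>e\<close>. The quotient \<open>x\<^sup>r\<close> is left free in the conclusion
  because \<open>squarefree_ideal_divide_var\<close> lowers an exponent that is at least 2 by lowering it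
  in \<open>r\<close>.
\<close>

lemma squarefree_monomial_idealE:
  fixes I :: "('n, 'k::field) mpoly set"
  assumes I: "squarefree_monomial_ideal I" and s: "s \<in> I" and nz: "Poly_Mapping.lookup s d \<noteq> 0"
  obtains e r where "squarefree_mdegree (mdegree_of_exp e)" "d = e + r"
    "\<And>r c. Poly_Mapping.single (e + r) c \<in> I"
proof -
  interpret R: module "(*) :: ('n, 'k) mpoly \<Rightarrow> _ \<Rightarrow> _"
    by unfold_locales (simp_all add: algebra_simps)
  obtain E where E: "\<forall>e\<in>E. squarefree_mdegree (mdegree_of_exp e)"
    and IE: "I = R.span (monom ` E)"
    using I unfolding squarefree_monomial_ideal_def by blast
  have "Poly_Mapping.lookup s d \<noteq> 0 \<longrightarrow> (\<exists>e\<in>E. \<exists>r. d = e + r)"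
    using s unfolding IE
  proof (induction s rule: R.span_induct_alt)
    case base
    show ?case by simp
  next
    case (step c x y)
    then obtain e where e: "e \<in> E" "x = monom e" by auto
    show ?case
    proof
      assume "Poly_Mapping.lookup (c * x + y) d \<noteq> 0"
      then consider "Poly_Mapping.lookup y d \<noteq> 0" | "Poly_Mapping.lookup (Poly_Mapping.single e 1 * c) d \<noteq> 0"
        by (cases "Poly_Mapping.lookup y d = 0") (auto simp: lookup_add e monom_def mult.commute[of c])
      then show "\<exists>e\<in>E. \<exists>r. d = e + r"
        using step e by cases (auto elim: lookup_single_times_nonzeroE)
    qed
  qed
  then obtain e r where e: "e \<in> E" "d = e + r" using nz by blast
  have "Poly_Mapping.single (e + r') c \<in> I" for r' c
    using R.span_scale[OF R.span_base[of "monom e" "monom ` E"], of "Poly_Mapping.single r' c"] e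
    by (simp add: IE monom_def mult_single add.commute)
  then show thesis using that e E by blast
qed

section \<open>Projections onto the homogeneous components\<close>

context multigraded_module
begin

lemma comp_monom:
  "f \<in> comp i \<alpha> \<Longrightarrow> add_mdegree (mdegree_of_exp e) \<alpha> = \<beta> \<Longrightarrow> scale (monom e) f \<in> comp i \<beta>"
  unfolding monom_def using comp_scale by blast

definition hdec :: "'m \<Rightarrow> nat \<times> ('n \<Rightarrow> int) \<Rightarrow> 'm" where
  "hdec f = (THE h. finite {q. h q \<noteq> 0} \<and> (\<forall>i \<alpha>. h (i, \<alpha>) \<in> comp i \<alpha>) \<and>
      f = (\<Sum>q | h q \<noteq> 0. h q))"

definition proj :: "nat \<Rightarrow> 'n mdegree \<Rightarrow> 'm \<Rightarrow> 'm" where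
  "proj i \<alpha> f = hdec f (i, \<alpha>)"

lemma
  shows finite_hdec: "finite {q. hdec f q \<noteq> 0}"
    and hdec_comp: "hdec f (i, \<alpha>) \<in> comp i \<alpha>"
    and sum_hdec: "(\<Sum>q | hdec f q \<noteq> 0. hdec f q) = f"
  using theI'[OF comp_direct_sum[of f]] unfolding hdec_def[symmetric] by auto

lemma hdec_eqI:
  assumes "finite A" "\<And>i \<alpha>. h (i, \<alpha>) \<in> comp i \<alpha>" "\<And>q. q \<notin> A \<Longrightarrow> h q = 0" "f = sum h A"
  shows "hdec f = h"
  unfolding hdec_def
proof (rule the1_equality[OF comp_direct_sum], intro conjI allI)
  have sub: "{q. h q \<noteq> 0} \<subseteq> A" using assms(3) by blast
  then show "finite {q. h q \<noteq> 0}" using assms(1) finite_subset by blast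
  show "f = (\<Sum>q | h q \<noteq> 0. h q)"
    unfolding assms(4) using sub assms(1) by (intro sum.mono_neutral_right) auto
qed (rule assms(2))

lemma proj_comp: "proj i \<alpha> f \<in> comp i \<alpha>"
  by (simp add: proj_def hdec_comp)

lemma proj_hom:
  assumes "f \<in> comp i \<alpha>"
  shows "proj j \<beta> f = (if i = j \<and> \<alpha> = \<beta> then f else 0)"
proof -
  have "hdec f = (\<lambda>q. if q = (i, \<alpha>) then f else 0)"
    by (rule hdec_eqI[of "{(i, \<alpha>)}"]) (auto simp: assms comp_zero)
  then show ?thesis by (auto simp: proj_def)
qed

lemma proj_same: "f \<in> comp i \<alpha> \<Longrightarrow> proj i \<alpha> f = f"
  by (simp add: proj_hom)

lemma proj_0 [simp]: "proj i \<alpha> 0 = 0"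
  by (rule proj_same[OF comp_zero])

lemma proj_add: "proj i \<alpha> (f + g) = proj i \<alpha> f + proj i \<alpha> g"
proof -
  let ?A = "{q. hdec f q \<noteq> 0} \<union> {q. hdec g q \<noteq> 0}"
  have fin: "finite ?A" using finite_hdec by blast
  have "f = sum (hdec f) ?A" "g = sum (hdec g) ?A"
    by (subst sum_hdec[symmetric], intro sum.mono_neutral_left fin; auto)+
  then have "hdec (f + g) = (\<lambda>q. hdec f q + hdec g q)"
    by (intro hdec_eqI[OF fin]) (auto simp: sum.distrib comp_add hdec_comp)
  then show ?thesis by (simp add: proj_def)
qed

lemma hom_unique: "f \<in> comp i \<alpha> \<Longrightarrow> f \<in> comp j \<beta> \<Longrightarrow> f \<noteq> 0 \<Longrightarrow> i = j \<and> \<alpha> = \<beta>"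
  using proj_hom[of f i \<alpha> j \<beta>] proj_same[of f j \<beta>] by (auto split: if_splits)

lemma homogeneous_induct [case_names zero add hom]:
  assumes zero: "P 0"
    and add: "\<And>f g. P f \<Longrightarrow> P g \<Longrightarrow> P (f + g)"
    and hom: "\<And>f i \<alpha>. f \<in> comp i \<alpha> \<Longrightarrow> P f"
  shows "P f"
proof -
  have "P (sum (hdec f) A)" for A
  proof (induction A rule: infinite_finite_induct)
    case (insert q A)
    then show ?case
      using add[OF hom[OF hdec_comp[of f "fst q" "snd q"]]] by simp
  qed (auto simp: zero)
  then show ?thesis using sum_hdec[of f] by metis
qed

lemma proj_scale_single:
  "proj i (add_mdegree (mdegree_of_exp e) \<alpha>) (scale (Poly_Mapping.single e c) f) =
    scale (Poly_Mapping.single e c) (proj i \<alpha> f)"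
proof (induction f rule: homogeneous_induct)
  case (hom f j \<beta>)
  show ?case
    using proj_hom[OF comp_scale[OF hom, of e c]] proj_hom[OF hom]
    by (simp add: add_mdegree_left_cancel)
qed (simp_all add: proj_add scale_right_distrib)

text \<open>
  A homogeneous element is a sum of terms \<open>c x\<^sup>e b\<close> with \<open>b\<close> a generator and \<open>e + deg b\<close> the
  degree of the element: write it as any combination of the generators and project this to its
  component, which kills the terms of other degrees.
\<close>

lemma hom_span_induct [consumes 3, case_names zero add single]:
  assumes f: "f \<in> comp p \<gamma>" "f \<in> span G" and G: "G \<subseteq> (\<Union>i \<alpha>. comp i \<alpha>)"
    and zero: "P 0"
    and add: "\<And>f g. P f \<Longrightarrow> P g \<Longrightarrow> P (f + g)"
    and multiple: "\<And>b \<beta> e c. b \<in> G \<Longrightarrow> b \<in> comp p \<beta> \<Longrightarrow>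
      add_mdegree (mdegree_of_exp e) \<beta> = \<gamma> \<Longrightarrow> P (scale (Poly_Mapping.single e c) b)"
  shows "P f"
proof -
  have "P (proj p \<gamma> f)"
    using f(2)
  proof (induction f rule: span_induct_alt)
    case base
    show ?case by (simp add: zero)
  next
    case (step s b y)
    then obtain i \<beta> where b: "b \<in> comp i \<beta>" using G by blast
    have "P (proj p \<gamma> (scale s b))"
    proof (induction s rule: mpoly_induct)
      case (single e c)
      show ?case
        using proj_hom[OF comp_scale[OF b, of e c], of p \<gamma>] multiple[OF step(1), of \<beta> e c] b
        by (auto simp: zero)
    qed (simp_all add: zero add scale_left_distrib proj_add)
    then show ?case by (simp add: proj_add add step)
  qed
  then show ?thesis by (simp add: proj_same[OF f(1)])
qed

definition irrelevant_multiples :: "'m set"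
  where "irrelevant_multiples = span {scale (var v) f | v f. True}"

lemma scale_var_irrelevant: "scale (var v) f \<in> irrelevant_multiples"
  unfolding irrelevant_multiples_def by (intro span_base) auto

lemma scale_single_irrelevant:
  assumes "e \<noteq> 0"
  shows "scale (Poly_Mapping.single e c) f \<in> irrelevant_multiples"
proof -
  obtain v where v: "Poly_Mapping.lookup e v \<noteq> 0" using assms by (metis poly_mapping_eqI lookup_zero)
  have "e = Poly_Mapping.single v 1 + (e - Poly_Mapping.single v 1)"
    using v by (intro poly_mapping_eqI) (auto simp: lookup_add lookup_minus lookup_single when_def)
  then have "Poly_Mapping.single e c = var v * Poly_Mapping.single (e - Poly_Mapping.single v 1) c"
    by (simp add: var_def monom_def mult_single)
  then show ?thesis
    by (metis scale_var_irrelevant scale_scale)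
qed

text \<open>
  Projecting makes the coefficients homogeneous. They then have smaller degree, which drives the
  inner induction of \<open>comp_subset_sums_of_product_parts\<close>.
\<close>

lemma irrelevant_multiples_hom:
  assumes f: "f \<in> comp p \<gamma>" "f \<in> irrelevant_multiples"
  obtains u where "\<And>v. u v \<in> comp p (lower v \<gamma>)" "f = (\<Sum>v\<in>UNIV. scale (var v) (u v))"
proof -
  have "\<exists>u. f = (\<Sum>v\<in>UNIV. scale (var v) (u v))"
    using f(2) unfolding irrelevant_multiples_def
  proof (induction f rule: span_induct_alt)
    case base
    show ?case by (rule exI[of _ "\<lambda>_. 0"]) simp
  next
    case (step s x y)
    then obtain v g u where x: "x = scale (var v) g" and y: "y = (\<Sum>v\<in>UNIV. scale (var v) (u v))"
      by blast
    have "(\<Sum>w\<in>UNIV. scale (var w) (if w = v then scale s g else 0)) =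
        (\<Sum>w\<in>UNIV. if w = v then scale s x else 0)"
      by (intro sum.cong) (auto simp: x mult.commute)
    then have "scale s x + y =
        (\<Sum>w\<in>UNIV. scale (var w) ((if w = v then scale s g else 0) + u w))"
      unfolding scale_right_distrib sum.distrib y by simp
    then show ?case by (intro exI[of _ "\<lambda>w. (if w = v then scale s g else 0) + u w"])
  qed
  then obtain u where u: "f = (\<Sum>v\<in>UNIV. scale (var v) (u v))" by blast
  have proj_sum: "proj p \<gamma> (sum h A) = (\<Sum>v\<in>A. proj p \<gamma> (h v))" for h and A :: "'n set"
    by (induction A rule: infinite_finite_induct) (simp_all add: proj_add)
  have "f = proj p \<gamma> f" by (simp add: proj_same f)
  also have "\<dots> = (\<Sum>v\<in>UNIV. scale (var v) (proj p (lower v \<gamma>) (u v)))"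
    unfolding u proj_sum
  proof (rule sum.cong[OF refl])
    fix v
    show "proj p \<gamma> (scale (var v) (u v)) = scale (var v) (proj p (lower v \<gamma>) (u v))"
      using proj_scale_single[of p "Poly_Mapping.single v 1" "lower v \<gamma>" 1 "u v"]
      by (simp add: var_def monom_def add_mdegree_var_lower del: One_nat_def)
  qed
  finally show thesis using that[of "\<lambda>v. proj p (lower v \<gamma>) (u v)"] proj_comp by blast
qed

end

section \<open>The degrees occurring in the resolution\<close>

context minimal_free_resolution
begin

interpretation d: module_hom scale scale \<delta>
  by (rule \<delta>_linear)

lemma comp_subset_hpart: "f \<in> comp i \<alpha> \<Longrightarrow> f \<in> hpart i"
  unfolding hpart_def by (intro span_base) blast

lemma \<delta>_in_comp: "f \<in> comp (Suc i) \<alpha> \<Longrightarrow> \<delta> f \<in> comp i \<alpha>"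
  using \<delta>_comp by blast

lemma \<delta>_\<delta>: "f \<in> comp (Suc (Suc i)) \<alpha> \<Longrightarrow> \<delta> (\<delta> f) = 0"
  using exact_Suc[of i] comp_subset_hpart by blast

lemma exact_hom: "f \<in> comp (Suc i) \<alpha> \<Longrightarrow> \<delta> f = 0 \<Longrightarrow> \<exists>h\<in>hpart (Suc (Suc i)). \<delta> h = f"
proof -
  assume "f \<in> comp (Suc i) \<alpha>" "\<delta> f = 0"
  then have "f \<in> \<delta> ` hpart (Suc (Suc i))" by (simp add: exact_Suc comp_subset_hpart)
  then show ?thesis by auto
qed

lemma range_\<delta>_irrelevant: "\<delta> f \<in> irrelevant_multiples"
  using minimal unfolding irrelevant_multiples_def by blast

lemma cycle_irrelevant: "f \<in> hpart (Suc i) \<Longrightarrow> \<delta> f = 0 \<Longrightarrow> f \<in> irrelevant_multiples"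
proof -
  assume "f \<in> hpart (Suc i)" "\<delta> f = 0"
  then have "f \<in> \<delta> ` hpart (Suc (Suc i))" by (simp add: exact_Suc)
  then show ?thesis using range_\<delta>_irrelevant by auto
qed

lemma torsion_free:
  assumes "scale (monom e) f = scale (monom e) g"
  shows "f = g"
proof -
  obtain B where B: "independent B" "span B = UNIV" using homogeneous_basis by blast
  have "(\<lambda>b. monom e * representation B (f - g) b) = (\<lambda>b. 0)"
    using representation_scale[of B "f - g" "monom e"] B assms
    by (simp add: scale_right_diff_distrib representation_zero)
  then have "representation B (f - g) b = 0" for b
    by (metis monom_times_eq_0_iff)
  then show ?thesis
    using sum_nonzero_representation_eq[of B "f - g"] B by simp
qed

text \<open>
  The coordinates of an element of \<open>(x\<^sub>1, \<dots>, x\<^sub>n) F\<close> have no constant term, but \<open>b\<close> has the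
  coordinate \<open>1\<close>.
\<close>

lemma basis_not_irrelevant:
  assumes B: "independent B" "span B = UNIV" and b: "b \<in> B"
  shows "b \<notin> irrelevant_multiples"
proof
  assume "b \<in> irrelevant_multiples"
  then have "Poly_Mapping.lookup (representation B b b) 0 = 0"
    unfolding irrelevant_multiples_def
  proof (induction rule: span_induct_alt[where h = "\<lambda>f. Poly_Mapping.lookup (representation B f b) 0 = 0"])
    case base
    show ?case by (simp add: representation_zero)
  next
    case (step s x y)
    then obtain v f where x: "x = scale (var v) f" by blast
    have "representation B (scale s x + y) b =
        var v * (s * representation B f b) + representation B y b"
      using B by (simp add: x representation_add representation_scale ac_simps)
    then show ?case using step(2) by (simp add: lookup_add lookup_var_times_0)
  qed
  then show False using representation_basis[OF B(1) b] by (simp add: lookup_one)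
qed

lemma one_nonzero: "one \<noteq> 0"
proof
  assume "one = 0"
  then have "scale 1 one = scale 0 one" by simp
  then have "(1 :: ('n, 'k) mpoly) = 0"
    using F0_eq_S unfolding bij_betw_def inj_on_def by blast
  then show False by simp
qed

lemma scale_one_inject: "scale s one = scale t one \<longleftrightarrow> s = t"
  using F0_eq_S unfolding bij_betw_def inj_on_def by blast

text \<open>
  The exponent is \<open>exp_of \<gamma>\<close> even when \<open>\<gamma>\<close> has negative entries; then only \<open>c = 0\<close> is possible.
\<close>

lemma comp_0E:
  assumes f: "f \<in> comp 0 \<gamma>"
  obtains c where "f = scale (Poly_Mapping.single (exp_of \<gamma>) c) one"
    "c \<noteq> 0 \<Longrightarrow> mdegree_of_exp (exp_of \<gamma>) = \<gamma>"
proof -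
  have "f \<in> (\<lambda>s. scale s one) ` UNIV"
    using comp_subset_hpart[OF f] F0_eq_S unfolding bij_betw_def by blast
  then have span: "f \<in> span {one}" by (auto intro: span_scale span_base)
  have "{one} \<subseteq> (\<Union>i \<alpha>. comp i \<alpha>)" using one_comp by blast
  with f span have "\<exists>c. f = scale (Poly_Mapping.single (exp_of \<gamma>) c) one \<and>
      (c \<noteq> 0 \<longrightarrow> mdegree_of_exp (exp_of \<gamma>) = \<gamma>)"
    (is "?P f")
  proof (induction rule: hom_span_induct[where P = ?P])
    case zero
    show ?case by (rule exI[of _ 0]) simp
  next
    case (add f g)
    then obtain c c' where
      "f = scale (Poly_Mapping.single (exp_of \<gamma>) c) one" "c \<noteq> 0 \<longrightarrow> mdegree_of_exp (exp_of \<gamma>) = \<gamma>"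
      "g = scale (Poly_Mapping.single (exp_of \<gamma>) c') one" "c' \<noteq> 0 \<longrightarrow> mdegree_of_exp (exp_of \<gamma>) = \<gamma>"
      by blast
    then show ?case
      by (intro exI[of _ "c + c'"]) (auto simp: single_add scale_left_distrib)
  next
    case (single b \<beta> e c)
    then have "\<beta> = (\<lambda>_. 0)" using hom_unique[OF one_comp _ one_nonzero] by blast
    then have e: "mdegree_of_exp e = \<gamma>" using single by simp
    then have "mdegree_of_exp (exp_of \<gamma>) = \<gamma>"
      by (intro mdegree_of_exp_exp_of) (metis mdegree_of_exp_nonneg)
    then have "exp_of \<gamma> = e" using e mdegree_of_exp_inject by metis
    then show ?case using single e by blast
  qed
  then show thesis using that by blast
qed

text \<open>
  A monomial multiple \<open>x\<^sup>e b\<close> with \<open>b\<close> of squarefree degree is divisible by the part of its degree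
  that exceeds \<open>(1, \<dots>, 1)\<close>, and this property is additive.
\<close>

lemma squarefree_generators_factor:
  assumes G: "G \<subseteq> (\<Union>i \<alpha>. comp i \<alpha>)" "span G = UNIV"
    and sqf: "\<And>b \<beta>. b \<in> G \<Longrightarrow> b \<in> comp p \<beta> \<Longrightarrow> squarefree_mdegree \<beta>"
    and f: "f \<in> comp p \<gamma>"
  shows "f = 0 \<or> (\<forall>v. 0 \<le> \<gamma> v)"
    and "\<exists>f'\<in>comp p (cap \<gamma>). f = scale (monom (excess \<gamma>)) f'"
proof -
  have "f \<in> span G" using G(2) by simp
  with f have "(f = 0 \<or> (\<forall>v. 0 \<le> \<gamma> v)) \<and> (\<exists>f'\<in>comp p (cap \<gamma>). f = scale (monom (excess \<gamma>)) f')"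
    using G(1)
  proof (induction rule: hom_span_induct)
    case zero
    show ?case by (intro conjI bexI[of _ 0]) (simp_all add: comp_zero)
  next
    case (add f g)
    then show ?case by (metis add.right_neutral scale_right_distrib comp_add)
  next
    case (single b \<beta> e c)
    have \<gamma>: "\<gamma> v = int (Poly_Mapping.lookup e v) + \<beta> v" for v
      using single(3) by (auto simp: add_mdegree_def mdegree_of_exp_def)
    have \<beta>: "0 \<le> \<beta> v" "\<beta> v \<le> 1" for v
      using sqf[OF single(1,2)] by (auto simp: squarefree_mdegree_def)
    have le: "Poly_Mapping.lookup (excess \<gamma>) v \<le> Poly_Mapping.lookup e v" for v
      using \<beta>[of v] by (simp add: excess_def cap_def \<gamma>)
    have split: "e = excess \<gamma> + (e - excess \<gamma>)"
      using le by (intro poly_mapping_eqI) (simp add: lookup_add lookup_minus)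
    then have "add_mdegree (mdegree_of_exp (excess \<gamma>)) (add_mdegree (mdegree_of_exp (e - excess \<gamma>)) \<beta>) = \<gamma>"
      using single(3) by (metis mdegree_of_exp_plus add_mdegree_assoc)
    then have "add_mdegree (mdegree_of_exp (e - excess \<gamma>)) \<beta> = cap \<gamma>"
      using excess_plus_cap add_mdegree_left_cancel by metis
    then have "scale (Poly_Mapping.single (e - excess \<gamma>) c) b \<in> comp p (cap \<gamma>)"
      using comp_scale[OF single(2)] by metis
    moreover have "scale (Poly_Mapping.single e c) b =
        scale (monom (excess \<gamma>)) (scale (Poly_Mapping.single (e - excess \<gamma>) c) b)"
      by (subst split) (simp add: monom_def mult_single)
    moreover have "\<forall>v. 0 \<le> \<gamma> v" using \<beta> by (simp add: \<gamma>)
    ultimately show ?case by blast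
  qed
  then show "f = 0 \<or> (\<forall>v. 0 \<le> \<gamma> v)" "\<exists>f'\<in>comp p (cap \<gamma>). f = scale (monom (excess \<gamma>)) f'"
    by blast+
qed

end

locale squarefree_resolution = minimal_free_resolution scale comp \<delta> one I
  for scale :: "('n::finite, 'k::field) mpoly \<Rightarrow> 'm::ab_group_add \<Rightarrow> 'm"
    and comp :: "nat \<Rightarrow> 'n mdegree \<Rightarrow> 'm set"
    and \<delta> :: "'m \<Rightarrow> 'm"
    and one :: 'm
    and I :: "('n, 'k) mpoly set" +
  assumes squarefree_ideal: "squarefree_monomial_ideal I"
begin

interpretation d: module_hom scale scale \<delta>
  by (rule \<delta>_linear)

text \<open>
  This is where the squarefreeness of the generators of \<open>I\<close> enters: if \<open>x\<^sub>v k \<in> I\<close>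
  and \<open>x\<^sub>v\<close> divides the monomial \<open>k\<close>, then \<open>k \<in> I\<close>, because a squarefree generator uses only one of the factors \<open>x\<^sub>v\<close>.
\<close>

lemma squarefree_ideal_divide_var:
  assumes "scale (var v) k \<in> \<delta> ` hpart 1" and k: "k \<in> comp 0 \<gamma>" and v: "1 \<le> \<gamma> v"
  shows "k \<in> \<delta> ` hpart 1"
proof -
  obtain s where s: "s \<in> I" "scale (var v) k = scale s one"
    using assms(1) exact_0 by auto
  obtain c where c: "k = scale (Poly_Mapping.single (exp_of \<gamma>) c) one"
    using comp_0E[OF k] by blast
  define x where "x = Poly_Mapping.single v (1::nat)"
  have s_eq: "s = Poly_Mapping.single (x + exp_of \<gamma>) c"
  proof -
    have "scale s one = scale (Poly_Mapping.single (x + exp_of \<gamma>) c) one"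
      unfolding s(2)[symmetric] c x_def by (simp add: var_def monom_def mult_single)
    then show ?thesis by (simp add: scale_one_inject)
  qed
  show ?thesis
  proof (cases "c = 0")
    case True
    have "0 \<in> hpart 1" unfolding hpart_def by (rule span_zero)
    then show ?thesis using c True d.zero by (metis image_eqI scale_zero_left single_zero)
  next
    case False
    then obtain e r where e: "squarefree_mdegree (mdegree_of_exp e)" "x + exp_of \<gamma> = e + r"
      and I: "\<And>r c. Poly_Mapping.single (e + r) c \<in> I"
      using squarefree_monomial_idealE[OF squarefree_ideal s(1), of "x + exp_of \<gamma>"]
      by (auto simp: s_eq)
    have er: "Poly_Mapping.lookup x w + nat (\<gamma> w) = Poly_Mapping.lookup e w + Poly_Mapping.lookup r w" for w
      using arg_cong[OF e(2), of "\<lambda>d. Poly_Mapping.lookup d w"] by (simp add: lookup_add)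
    have e1: "Poly_Mapping.lookup e v \<le> 1"
      using e(1) unfolding squarefree_mdegree_def mdegree_of_exp_def by (metis of_nat_le_1_iff)
    have "exp_of \<gamma> = e + (r - x)"
    proof (rule poly_mapping_eqI)
      fix w
      show "Poly_Mapping.lookup (exp_of \<gamma>) w = Poly_Mapping.lookup (e + (r - x)) w"
        using er[of w] e1 v by (cases "w = v") (auto simp: x_def lookup_add lookup_minus lookup_single)
    qed
    then have "Poly_Mapping.single (exp_of \<gamma>) c \<in> I" using I by metis
    then show ?thesis using c exact_0 by blast
  qed
qed

text \<open>
  Induction on the homological degree. If a degree had an entry \<open>\<gamma> v \<ge> 2\<close>, then
  \<open>\<delta> b = x\<^sub>v k\<close> by the induction hypothesis one step below. Here \<open>k\<close> is again a boundary \<open>\<delta> h\<close>, so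
  \<open>b - x\<^sub>v h\<close> is a cycle and lies in \<open>(x\<^sub>1, \<dots>, x\<^sub>n) F\<close> by minimality. Then \<open>b\<close> lies there too,
  which is impossible for a basis element. If a degree had a negative entry, then \<open>b\<close> itself
  would be a cycle.
\<close>

theorem basis_squarefree:
  assumes B: "B \<subseteq> (\<Union>i \<alpha>. comp i \<alpha>)" "independent B" "span B = UNIV"
    and "b \<in> B" "b \<in> comp p \<gamma>"
  shows "squarefree_mdegree \<gamma>"
  using assms(4,5)
proof (induction p arbitrary: b \<gamma>)
  case 0
  obtain c where c: "b = scale (Poly_Mapping.single (exp_of \<gamma>) c) one"
    "c \<noteq> 0 \<Longrightarrow> mdegree_of_exp (exp_of \<gamma>) = \<gamma>"
    using comp_0E[OF 0(2)] by blast
  have b: "b \<notin> irrelevant_multiples" by (rule basis_not_irrelevant[OF B(2,3) 0(1)])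
  then have "exp_of \<gamma> = 0" using c(1) scale_single_irrelevant by blast
  moreover have "c \<noteq> 0" using b c(1) unfolding irrelevant_multiples_def by (auto simp: span_zero)
  ultimately have "\<gamma> = (\<lambda>_. 0)" using c(2) by (simp add: mdegree_of_exp_0)
  then show ?case by (simp add: squarefree_mdegree_def)
next
  case (Suc p)
  note b = basis_not_irrelevant[OF B(2,3) Suc.prems(1)]
  note hb = comp_subset_hpart[OF Suc.prems(2)]
  have db: "\<delta> b \<in> comp p \<gamma>" by (rule \<delta>_in_comp[OF Suc.prems(2)])
  have sqf: "squarefree_mdegree \<beta>" if "b' \<in> B" "b' \<in> comp p \<beta>" for b' \<beta>
    using Suc.IH that by blast
  note factor = squarefree_generators_factor[OF B(1,3) _ db]
  have "\<delta> b \<noteq> 0" using cycle_irrelevant[OF hb] b by blast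
  then have nonneg: "0 \<le> \<gamma> v" for v using factor(1) sqf by blast
  have "\<gamma> v \<le> 1" for v
  proof (rule ccontr)
    assume "\<not> \<gamma> v \<le> 1"
    then have v: "2 \<le> \<gamma> v" by simp
    define x where "x = Poly_Mapping.single v (1::nat)"
    obtain f' where f': "f' \<in> comp p (cap \<gamma>)" "\<delta> b = scale (monom (excess \<gamma>)) f'"
      using factor(2) sqf by blast
    have ex: "excess \<gamma> = x + (excess \<gamma> - x)"
      using v by (intro poly_mapping_eqI)
        (auto simp: x_def lookup_add lookup_minus lookup_single when_def excess_def cap_def)
    define k where "k = scale (monom (excess \<gamma> - x)) f'"
    have dbk: "\<delta> b = scale (var v) k"
      using ex unfolding k_def f'(2) var_def scale_scale monom_mult x_def by metis
    have "add_mdegree (mdegree_of_exp x) (add_mdegree (mdegree_of_exp (excess \<gamma> - x)) (cap \<gamma>)) = \<gamma>"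
      using ex excess_plus_cap by (metis mdegree_of_exp_plus add_mdegree_assoc)
    then have "add_mdegree (mdegree_of_exp (excess \<gamma> - x)) (cap \<gamma>) = lower v \<gamma>"
      unfolding x_def using add_mdegree_var_lower add_mdegree_left_cancel by metis
    then have k: "k \<in> comp p (lower v \<gamma>)" unfolding k_def by (rule comp_monom[OF f'(1)])
    \<comment> \<open>\<open>k\<close> is a boundary: by the shape of \<open>I\<close> in \<open>F\<^sub>0\<close>, and as a cycle in higher degrees.\<close>
    have "k \<in> \<delta> ` hpart (Suc p)"
    proof (cases p)
      case 0
      have "scale (var v) k \<in> \<delta> ` hpart 1" using imageI[OF hb, of \<delta>] dbk 0 by simp
      moreover have "1 \<le> lower v \<gamma> v" using v by (simp add: lower_def)
      ultimately show ?thesis using squarefree_ideal_divide_var k 0 by simp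
    next
      case (Suc q)
      have "scale (var v) (\<delta> k) = \<delta> (\<delta> b)" by (simp add: dbk d.scale)
      also have "\<dots> = 0" using \<delta>_\<delta> Suc.prems(2) Suc by blast
      also have "\<dots> = scale (var v) 0" by simp
      finally have "\<delta> k = 0" unfolding var_def by (rule torsion_free)
      then show ?thesis using exact_hom k Suc by blast
    qed
    then obtain h where h: "h \<in> hpart (Suc p)" "k = \<delta> h" by blast
    have "b - scale (var v) h \<in> irrelevant_multiples"
    proof (rule cycle_irrelevant)
      show "b - scale (var v) h \<in> hpart (Suc p)"
        using hb h(1) unfolding hpart_def by (intro span_diff span_scale)
      show "\<delta> (b - scale (var v) h) = 0" by (simp add: d.diff d.scale dbk h(2))
    qed
    then have "(b - scale (var v) h) + scale (var v) h \<in> irrelevant_multiples"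
      using scale_var_irrelevant[of v h] unfolding irrelevant_multiples_def by (rule span_add)
    then show False using b by simp
  qed
  then show ?case using nonneg by (simp add: squarefree_mdegree_def)
qed

section \<open>Squarefree parts\<close>

lemma comp_nonneg: "f \<in> comp p \<gamma> \<Longrightarrow> f \<noteq> 0 \<Longrightarrow> 0 \<le> \<gamma> v"
  using homogeneous_basis squarefree_generators_factor(1) basis_squarefree by metis

text \<open>
  For \<open>f \<noteq> 0\<close> the degree of \<open>f\<close> is unique and determines the monomial factor, which can then be
  cancelled.
\<close>

lemma sqf_part_eqI:
  assumes f: "f \<in> comp p \<gamma>" and f': "f' \<in> comp p (cap \<gamma>)" and eq: "f = scale (monom e) f'"
  shows "sqf_part f = f'"
proof (cases "f = 0")
  case True
  then have "scale (monom e) f' = scale (monom e) 0" using eq by simp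
  then show ?thesis using True torsion_free by (auto simp: sqf_part_def)
next
  case False
  show ?thesis
    unfolding sqf_part_def if_not_P[OF False]
  proof (rule the_equality)
    show "\<exists>i \<alpha> e. f \<in> comp i \<alpha> \<and> f' \<in> comp i (\<lambda>v. min (\<alpha> v) 1) \<and> f = scale (monom e) f'"
      using assms unfolding cap_def by blast
    fix f''
    assume "\<exists>i \<alpha> e. f \<in> comp i \<alpha> \<and> f'' \<in> comp i (\<lambda>v. min (\<alpha> v) 1) \<and> f = scale (monom e) f''"
    then obtain i \<alpha> d where *: "f \<in> comp i \<alpha>" "f'' \<in> comp i (cap \<alpha>)" "f = scale (monom d) f''"
      unfolding cap_def by blast
    then have i: "i = p" "\<alpha> = \<gamma>" using hom_unique[OF f _ False] by auto
    have "f \<in> comp p (add_mdegree (mdegree_of_exp d) (cap \<gamma>))"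
      "f \<in> comp p (add_mdegree (mdegree_of_exp e) (cap \<gamma>))"
      using comp_monom[OF *(2) refl, of d] comp_monom[OF f' refl, of e] *(3) eq i by auto
    then have "add_mdegree (mdegree_of_exp d) (cap \<gamma>) = add_mdegree (mdegree_of_exp e) (cap \<gamma>)"
      using hom_unique False by blast
    then have "d = e"
      by (auto simp: add_mdegree_def mdegree_of_exp_def fun_eq_iff intro: poly_mapping_eqI)
    then show "f'' = f'" using * eq torsion_free by blast
  qed
qed

lemma sqf_part_factor:
  assumes f: "f \<in> comp p \<gamma>"
  shows "sqf_part f \<in> comp p (cap \<gamma>)" "f = scale (monom (excess \<gamma>)) (sqf_part f)"
proof -
  obtain B where B: "B \<subseteq> (\<Union>i \<alpha>. comp i \<alpha>)" "independent B" "span B = UNIV"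
    using homogeneous_basis by blast
  obtain f' where "f' \<in> comp p (cap \<gamma>)" "f = scale (monom (excess \<gamma>)) f'"
    using squarefree_generators_factor(2)[OF B(1,3) _ f] basis_squarefree[OF B] by blast
  moreover from this have "sqf_part f = f'" by (rule sqf_part_eqI[OF f])
  ultimately show "sqf_part f \<in> comp p (cap \<gamma>)" "f = scale (monom (excess \<gamma>)) (sqf_part f)"
    by simp_all
qed

lemma sqf_part_0 [simp]: "sqf_part 0 = 0"
  by (simp add: sqf_part_def)

lemma sqf_part_add:
  assumes "f \<in> comp p \<gamma>" "g \<in> comp p \<gamma>"
  shows "sqf_part (f + g) = sqf_part f + sqf_part g"
proof (rule sqf_part_eqI)
  show "f + g \<in> comp p \<gamma>" by (rule comp_add[OF assms])
  show "sqf_part f + sqf_part g \<in> comp p (cap \<gamma>)"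
    using sqf_part_factor(1) assms comp_add by blast
  show "f + g = scale (monom (excess \<gamma>)) (sqf_part f + sqf_part g)"
    using sqf_part_factor(2) assms by (metis scale_right_distrib)
qed

lemma sqf_part_monom:
  assumes f: "f \<in> comp p \<gamma>" and "scale (monom e) f \<in> comp p \<beta>" "cap \<beta> = cap \<gamma>"
  shows "sqf_part (scale (monom e) f) = sqf_part f"
proof (rule sqf_part_eqI[OF assms(2)])
  show "sqf_part f \<in> comp p (cap \<beta>)" using sqf_part_factor(1)[OF f] assms(3) by simp
  show "scale (monom e) f = scale (monom (e + excess \<gamma>)) (sqf_part f)"
    by (subst sqf_part_factor(2)[OF f]) (simp add: monom_mult)
qed

section \<open>A generator of the ideal below each degree\<close>

lemma proj_\<delta>: "proj i \<gamma> (\<delta> f) = \<delta> (proj (Suc i) \<gamma> f)"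
proof (induction f rule: homogeneous_induct)
  case (hom f j \<beta>)
  show ?case
  proof (cases j)
    case 0
    then have "\<delta> f = 0" using hom comp_subset_hpart \<delta>_F0 by blast
    then show ?thesis using proj_hom[OF hom] 0 by simp
  next
    case (Suc m)
    then have "\<delta> f \<in> comp m \<beta>" using hom \<delta>_in_comp by blast
    then show ?thesis using proj_hom[OF hom] proj_hom[of "\<delta> f" m \<beta>] Suc by simp
  qed
qed (simp_all add: proj_add d.add)

text \<open>
  A basis element \<open>b\<close> of positive homological degree has \<open>\<delta> b \<noteq> 0\<close> by minimality, so a monomial of
  \<open>I\<close> below the degree of \<open>b\<close> is found by applying \<open>\<delta>\<close> until \<open>F\<^sub>0 = S\<close> is reached.
\<close>

lemma monom_in_ideal_below:
  assumes "f \<in> comp (Suc p) \<gamma>" "f \<noteq> 0"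
  shows "\<exists>e. monom e \<in> I \<and> (\<forall>v. mdegree_of_exp e v \<le> \<gamma> v)" (is "?Q \<gamma>")
  using assms
proof (induction p arbitrary: f \<gamma> rule: less_induct)
  case (less p)
  obtain B where B: "B \<subseteq> (\<Union>i \<alpha>. comp i \<alpha>)" "independent B" "span B = UNIV"
    using homogeneous_basis by blast
  have basis: "?Q \<beta>" if b: "b \<in> B" "b \<in> comp (Suc p) \<beta>" for b \<beta>
  proof -
    have hb: "b \<in> hpart (Suc p)" by (rule comp_subset_hpart[OF b(2)])
    have nz: "\<delta> b \<noteq> 0"
      using cycle_irrelevant[OF hb] basis_not_irrelevant[OF B(2,3) b(1)] by blast
    have db: "\<delta> b \<in> comp p \<beta>" by (rule \<delta>_in_comp[OF b(2)])
    show ?thesis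
    proof (cases p)
      case 0
      then obtain c where c: "\<delta> b = scale (Poly_Mapping.single (exp_of \<beta>) c) one"
        "c \<noteq> 0 \<Longrightarrow> mdegree_of_exp (exp_of \<beta>) = \<beta>"
        using comp_0E db by metis
      have "c \<noteq> 0" using nz c(1) by auto
      obtain s where s: "s \<in> I" "\<delta> b = scale s one" using exact_0 hb 0 by auto
      then have "s = Poly_Mapping.single (exp_of \<beta>) c" using c(1) scale_one_inject by simp
      then obtain e r where "exp_of \<beta> = e + r" "\<And>r c. Poly_Mapping.single (e + r) c \<in> I"
        using squarefree_monomial_idealE[OF squarefree_ideal s(1), of "exp_of \<beta>"] \<open>c \<noteq> 0\<close>
        by (metis lookup_single_eq)
      then have "monom (exp_of \<beta>) \<in> I" by (simp add: monom_def)
      then show ?thesis using c(2) \<open>c \<noteq> 0\<close> by (metis order.refl)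
    next
      case (Suc q)
      then show ?thesis using less.IH[of q] db nz by blast
    qed
  qed
  have "f \<in> span B" by (simp add: B(3))
  with less.prems(1) have "f = 0 \<or> ?Q \<gamma>"
    using B(1)
  proof (induction rule: hom_span_induct)
    case (single b \<beta> e c)
    have "\<beta> v \<le> \<gamma> v" for v
      using single(3) mdegree_of_exp_nonneg[of e v] by (auto simp: add_mdegree_def)
    then show ?case using basis[OF single(1,2)] order.trans by blast
  qed auto
  then show ?case using less.prems(2) by blast
qed

lemma generator_below:
  assumes "f \<in> comp (Suc p) \<gamma>" "f \<noteq> 0"
  obtains g e where "g \<in> comp 1 (mdegree_of_exp e)" "\<delta> g = scale (monom e) one"
    "\<And>v. mdegree_of_exp e v \<le> \<gamma> v"
proof -
  obtain e where e: "monom e \<in> I" "\<And>v. mdegree_of_exp e v \<le> \<gamma> v"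
    using monom_in_ideal_below[OF assms] by blast
  then obtain g where g: "\<delta> g = scale (monom e) one" using exact_0 by (metis (lifting) imageE imageI)
  have "scale (monom e) one \<in> comp 0 (mdegree_of_exp e)" by (rule comp_monom[OF one_comp]) simp
  then have "\<delta> (proj 1 (mdegree_of_exp e) g) = scale (monom e) one"
    using proj_\<delta>[of 0 "mdegree_of_exp e" g] by (simp add: g proj_same)
  then show thesis using that[OF proj_comp] e(2) by blast
qed

end

section \<open>Iterated products of elements of homological degree one\<close>

locale squarefree_resolution_multiplication =
  resolution_multiplication scale comp \<delta> one I mult + squarefree_resolution scale comp \<delta> one I
  for scale :: "('n::finite, 'k::field) mpoly \<Rightarrow> 'm::ab_group_add \<Rightarrow> 'm"
    and comp :: "nat \<Rightarrow> 'n mdegree \<Rightarrow> 'm set"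
    and \<delta> :: "'m \<Rightarrow> 'm"
    and one :: 'm
    and I :: "('n, 'k) mpoly set"
    and mult :: "'m \<Rightarrow> 'm \<Rightarrow> 'm"
begin

interpretation d: module_hom scale scale \<delta>
  by (rule \<delta>_linear)

interpretation mr: module_hom scale scale "mult a" for a
  by (rule mult_linear_right)

interpretation ml: module_hom scale scale "\<lambda>a. mult a b" for b
  by (rule mult_linear_left)

text \<open>
  The degree \<open>\<alpha>\<close> is the one of the squarefree part. The product itself may have a larger degree
  \<open>\<gamma>\<close>, of which nothing but the minimum with \<open>(1, \<dots>, 1)\<close> has to be remembered.
\<close>

definition product_parts :: "nat \<Rightarrow> 'n mdegree \<Rightarrow> 'm set" where
  "product_parts p \<alpha> = {sqf_part (right_nested mult gs) | gs \<gamma>.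
    length gs = p \<and> set gs \<subseteq> (\<Union>\<beta>. comp 1 \<beta>) \<and>
    right_nested mult gs \<in> comp p \<gamma> \<and> cap \<gamma> = \<alpha>}"

definition sums_of_product_parts :: "nat \<Rightarrow> 'n mdegree \<Rightarrow> 'm set" where
  "sums_of_product_parts p \<alpha> = {sum_list zs | zs. set zs \<subseteq> product_parts p \<alpha>}"

lemma sums_of_product_partsI: "z \<in> product_parts p \<alpha> \<Longrightarrow> z \<in> sums_of_product_parts p \<alpha>"
  unfolding sums_of_product_parts_def by (intro CollectI exI[of _ "[z]"]) simp

lemma sums_of_product_parts_0: "0 \<in> sums_of_product_parts p \<alpha>"
  unfolding sums_of_product_parts_def by (intro CollectI exI[of _ "[]"]) simp

lemma sums_of_product_parts_add:
  assumes "f \<in> sums_of_product_parts p \<alpha>" "g \<in> sums_of_product_parts p \<alpha>"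
  shows "f + g \<in> sums_of_product_parts p \<alpha>"
proof -
  obtain xs ys where "f = sum_list xs" "set xs \<subseteq> product_parts p \<alpha>"
    "g = sum_list ys" "set ys \<subseteq> product_parts p \<alpha>"
    using assms unfolding sums_of_product_parts_def by blast
  then show ?thesis
    unfolding sums_of_product_parts_def by (intro CollectI exI[of _ "xs @ ys"]) simp
qed

lemma sums_of_product_parts_sum:
  "(\<And>x. x \<in> A \<Longrightarrow> h x \<in> sums_of_product_parts p \<alpha>) \<Longrightarrow> sum h A \<in> sums_of_product_parts p \<alpha>"
  by (induction A rule: infinite_finite_induct)
    (auto simp: sums_of_product_parts_0 sums_of_product_parts_add)

lemma sums_of_product_parts_induct [consumes 1, case_names zero add part]:
  assumes "f \<in> sums_of_product_parts p \<alpha>"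
    and "P 0" "\<And>f g. f \<in> sums_of_product_parts p \<alpha> \<Longrightarrow> g \<in> sums_of_product_parts p \<alpha> \<Longrightarrow>
      P f \<Longrightarrow> P g \<Longrightarrow> P (f + g)"
    and "\<And>z. z \<in> product_parts p \<alpha> \<Longrightarrow> P z"
  shows "P f"
proof -
  obtain zs where zs: "f = sum_list zs" "set zs \<subseteq> product_parts p \<alpha>"
    using assms(1) unfolding sums_of_product_parts_def by blast
  have "sum_list zs \<in> sums_of_product_parts p \<alpha> \<and> P (sum_list zs)"
    using zs(2)
    by (induction zs)
      (auto simp: assms sums_of_product_parts_0 sums_of_product_parts_add sums_of_product_partsI)
  then show ?thesis using zs(1) by simp
qed

lemma product_parts_comp: "z \<in> product_parts p \<alpha> \<Longrightarrow> z \<in> comp p \<alpha>"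
  unfolding product_parts_def using sqf_part_factor(1) by blast

lemma sums_of_product_parts_comp: "f \<in> sums_of_product_parts p \<alpha> \<Longrightarrow> f \<in> comp p \<alpha>"
  by (induction rule: sums_of_product_parts_induct)
    (auto simp: comp_zero comp_add product_parts_comp)

text \<open>
  The variable can be absorbed in the first factor. Since \<open>x\<^sub>v\<close> does not divide the degree of
  \<open>z\<close>, nor that of the product whose squarefree part is \<open>z\<close>, the multiplication by \<open>x\<^sub>v\<close>
  commutes with taking the squarefree part.
\<close>

lemma product_parts_var:
  assumes z: "z \<in> product_parts (Suc p) (lower v \<alpha>)" and v: "\<alpha> v = 1"
  shows "scale (var v) z \<in> product_parts (Suc p) \<alpha>"
proof -
  define x where "x = Poly_Mapping.single v (1::nat)"
  obtain gs \<gamma> where z_eq: "z = sqf_part (right_nested mult gs)" and gs: "length gs = Suc p"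
    "set gs \<subseteq> (\<Union>\<beta>. comp 1 \<beta>)" "right_nested mult gs \<in> comp (Suc p) \<gamma>" "cap \<gamma> = lower v \<alpha>"
    using z unfolding product_parts_def by blast
  obtain g gs' where g: "gs = g # gs'" using gs(1) by (cases gs) auto
  have nested: "scale (var v) (right_nested mult gs) = right_nested mult (scale (var v) g # gs')"
    unfolding g by (cases gs') (simp_all add: ml.scale)
  let ?\<gamma> = "add_mdegree (mdegree_of_exp x) \<gamma>"
  have "\<gamma> v = 0" using fun_cong[OF gs(4), of v] v by (simp add: cap_def lower_def)
  then have cap: "cap ?\<gamma> = \<alpha>"
    using gs(4) v
    by (auto simp: fun_eq_iff cap_def lower_def x_def mdegree_of_exp_single add_mdegree_def simp del: One_nat_def)
  have comp: "scale (var v) (right_nested mult gs) \<in> comp (Suc p) ?\<gamma>"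
    unfolding var_def x_def by (rule comp_monom[OF gs(3) refl])
  obtain \<beta> where "g \<in> comp 1 \<beta>" using gs(2) g by auto
  then have "scale (var v) g \<in> comp 1 (add_mdegree (mdegree_of_exp x) \<beta>)"
    unfolding var_def x_def by (rule comp_monom) simp
  then have set: "set (scale (var v) g # gs') \<subseteq> (\<Union>\<beta>. comp 1 \<beta>)" using gs(2) g by auto
  have "sqf_part (scale (var v) (right_nested mult gs)) = scale (var v) z"
  proof (rule sqf_part_eqI[OF comp])
    show "scale (var v) z \<in> comp (Suc p) (cap ?\<gamma>)"
      unfolding cap var_def
      by (rule comp_monom[OF product_parts_comp[OF z]]) (rule add_mdegree_var_lower)
    show "scale (var v) (right_nested mult gs) = scale (monom (excess \<gamma>)) (scale (var v) z)"
      unfolding z_eq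
      by (subst sqf_part_factor(2)[OF gs(3)]) (simp add: mult.commute)
  qed
  then show ?thesis
    unfolding product_parts_def using nested comp cap gs(1) g set
    by (intro CollectI exI[of _ "scale (var v) g # gs'"] exI[of _ ?\<gamma>]) auto
qed

text \<open>
  The product with \<open>z = |w|\<^sub>s\<^sub>q\<^sub>f\<close> and the product with \<open>w\<close> differ by a monomial factor, and both
  degrees have minimum \<open>\<alpha>\<close> with \<open>(1, \<dots>, 1)\<close> because \<open>e \<le> \<alpha>\<close>, so their squarefree parts agree.
\<close>

lemma product_parts_mult:
  assumes z: "z \<in> product_parts (Suc p) \<alpha>"
    and g: "g \<in> comp 1 (mdegree_of_exp e)" and e: "\<And>v. mdegree_of_exp e v \<le> \<alpha> v"
    and \<alpha>: "squarefree_mdegree \<alpha>"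
  shows "sqf_part (mult g z) \<in> product_parts (Suc (Suc p)) \<alpha>"
proof -
  obtain gs \<gamma> where z_eq: "z = sqf_part (right_nested mult gs)" and gs: "length gs = Suc p"
    "set gs \<subseteq> (\<Union>\<beta>. comp 1 \<beta>)" "right_nested mult gs \<in> comp (Suc p) \<gamma>" "cap \<gamma> = \<alpha>"
    using z unfolding product_parts_def by blast
  have nested: "right_nested mult (g # gs) = mult g (right_nested mult gs)"
    using gs(1) by (cases gs) auto
  let ?\<gamma> = "add_mdegree (mdegree_of_exp e) \<gamma>"
  let ?\<alpha> = "add_mdegree (mdegree_of_exp e) \<alpha>"
  have \<alpha>01: "0 \<le> \<alpha> v" "\<alpha> v \<le> 1" for v using \<alpha> by (auto simp: squarefree_mdegree_def)
  have cap_\<gamma>: "cap ?\<gamma> = \<alpha>" and cap_\<alpha>: "cap ?\<alpha> = \<alpha>"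
  proof -
    have "min (mdegree_of_exp e v + \<gamma> v) 1 = \<alpha> v \<and> min (mdegree_of_exp e v + \<alpha> v) 1 = \<alpha> v" for v
      using \<alpha>01[of v] e[of v] mdegree_of_exp_nonneg[of e v] fun_cong[OF gs(4), of v]
      unfolding cap_def by linarith
    then show "cap ?\<gamma> = \<alpha>" "cap ?\<alpha> = \<alpha>" by (simp_all add: cap_def add_mdegree_def fun_eq_iff)
  qed
  have comp: "mult g (right_nested mult gs) \<in> comp (Suc (Suc p)) ?\<gamma>"
    using mult_comp[OF g gs(3)] by simp
  have "mult g (right_nested mult gs) = scale (monom (excess \<gamma>)) (mult g z)"
    unfolding z_eq by (subst sqf_part_factor(2)[OF gs(3)]) (simp add: mr.scale)
  moreover have "mult g z \<in> comp (Suc (Suc p)) ?\<alpha>"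
    using mult_comp[OF g product_parts_comp[OF z]] by simp
  ultimately have "sqf_part (mult g (right_nested mult gs)) = sqf_part (mult g z)"
    using sqf_part_monom comp cap_\<gamma> cap_\<alpha> by metis
  then show ?thesis
    unfolding product_parts_def using comp cap_\<gamma> gs(1,2) g nested
    by (intro CollectI exI[of _ "g # gs"] exI[of _ ?\<gamma>]) auto
qed

lemma sums_of_product_parts_mult:
  assumes "z \<in> sums_of_product_parts (Suc p) \<alpha>"
    and g: "g \<in> comp 1 (mdegree_of_exp e)" and e: "\<And>v. mdegree_of_exp e v \<le> \<alpha> v"
    and \<alpha>: "squarefree_mdegree \<alpha>"
  shows "sqf_part (mult g z) \<in> sums_of_product_parts (Suc (Suc p)) \<alpha>"
  using assms(1)
proof (induction rule: sums_of_product_parts_induct)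
  case zero
  show ?case by (simp add: mr.zero sums_of_product_parts_0)
next
  case (add f h)
  have "sqf_part (mult g f + mult g h) = sqf_part (mult g f) + sqf_part (mult g h)"
    by (rule sqf_part_add; rule mult_comp[OF g sums_of_product_parts_comp]; rule add(1,2))
  then show ?case using add by (simp add: mr.add sums_of_product_parts_add)
next
  case (part z)
  show ?case by (rule sums_of_product_partsI[OF product_parts_mult[OF part g e \<alpha>]])
qed

lemma sums_of_product_parts_var:
  assumes "z \<in> sums_of_product_parts (Suc p) (lower v \<alpha>)" and v: "\<alpha> v = 1"
  shows "scale (var v) z \<in> sums_of_product_parts (Suc p) \<alpha>"
  using assms(1)
  by (induction rule: sums_of_product_parts_induct)
    (auto simp: scale_right_distrib sums_of_product_parts_0 sums_of_product_parts_add
      intro: sums_of_product_partsI product_parts_var v)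

text \<open>
  The Leibniz rule reads \<open>x\<^sup>e f = \<delta> (g * f) + g * \<delta> f\<close>. Both products have degree \<open>e + \<alpha>\<close>, and since
  \<open>e \<le> \<alpha> \<le> 1\<close>, they are \<open>x\<^sup>e\<close> times their squarefree parts, so \<open>x\<^sup>e\<close> can be cancelled.
\<close>

lemma sqf_part_homotopy:
  assumes f: "f \<in> comp (Suc p) \<alpha>" and \<alpha>: "squarefree_mdegree \<alpha>"
    and g: "g \<in> comp 1 (mdegree_of_exp e)" "\<delta> g = scale (monom e) one"
    and e: "\<And>v. mdegree_of_exp e v \<le> \<alpha> v"
  shows "f = \<delta> (sqf_part (mult g f)) + sqf_part (mult g (\<delta> f))"
    and "sqf_part (mult g f) \<in> comp (Suc (Suc p)) \<alpha>"
proof -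
  let ?\<alpha> = "add_mdegree (mdegree_of_exp e) \<alpha>"
  have \<alpha>01: "0 \<le> \<alpha> v" "\<alpha> v \<le> 1" for v using \<alpha> by (auto simp: squarefree_mdegree_def)
  have cap: "cap ?\<alpha> = \<alpha>"
  proof
    fix v
    show "cap ?\<alpha> v = \<alpha> v"
      using \<alpha>01[of v] e[of v] mdegree_of_exp_nonneg[of e v]
      unfolding cap_def add_mdegree_def by linarith
  qed
  have "add_mdegree (mdegree_of_exp (excess ?\<alpha>)) \<alpha> = ?\<alpha>"
    using excess_plus_cap[of ?\<alpha>] cap by simp
  then have excess: "excess ?\<alpha> = e"
    by (auto simp: add_mdegree_def mdegree_of_exp_def fun_eq_iff intro: poly_mapping_eqI)
  have gf: "mult g f \<in> comp (Suc (Suc p)) ?\<alpha>" using mult_comp[OF g(1) f] by simp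
  have gdf: "mult g (\<delta> f) \<in> comp (Suc p) ?\<alpha>"
    using mult_comp[OF g(1) \<delta>_in_comp[OF f]] by simp
  show "sqf_part (mult g f) \<in> comp (Suc (Suc p)) \<alpha>" using sqf_part_factor(1)[OF gf] cap by simp
  have "\<delta> (mult g f) = scale (monom e) f - mult g (\<delta> f)"
    using leibniz[OF g(1) f] by (simp add: g(2) ml.scale mult_one_left)
  moreover have "\<delta> (mult g f) = scale (monom e) (\<delta> (sqf_part (mult g f)))"
    by (subst sqf_part_factor(2)[OF gf]) (simp add: excess d.scale)
  moreover have "mult g (\<delta> f) = scale (monom e) (sqf_part (mult g (\<delta> f)))"
    using sqf_part_factor(2)[OF gdf] excess by simp
  ultimately have "scale (monom e) f =
      scale (monom e) (\<delta> (sqf_part (mult g f)) + sqf_part (mult g (\<delta> f)))"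
    by (simp add: scale_right_distrib)
  then show "f = \<delta> (sqf_part (mult g f)) + sqf_part (mult g (\<delta> f))" by (rule torsion_free)
qed

text \<open>
  Induction on the homological degree, and for fixed homological degree on the total degree of \<open>\<alpha>\<close>.
  In \<open>f = \<delta> h + |g * \<delta> f|\<^sub>s\<^sub>q\<^sub>f\<close> the outer hypothesis applies to \<open>\<delta> f\<close>. The summand \<open>\<delta> h\<close> has the
  same homological degree as \<open>f\<close>, but by minimality it is a combination \<open>\<Sum>\<^sub>v x\<^sub>v u\<^sub>v\<close>, and the inner
  hypothesis applies to the \<open>u\<^sub>v\<close>.
\<close>

theorem comp_subset_sums_of_product_parts:
  assumes "f \<in> comp (Suc p) \<alpha>" "squarefree_mdegree \<alpha>"
  shows "f \<in> sums_of_product_parts (Suc p) \<alpha>"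
  using assms
proof (induction p arbitrary: f \<alpha>)
  case 0
  have "f = sqf_part f"
    by (rule sqf_part_eqI[symmetric, where e = 0 and \<gamma> = \<alpha> and p = 1])
      (use 0 in \<open>simp_all add: cap_squarefree monom_def single_one\<close>)
  then have "f \<in> product_parts 1 \<alpha>"
    unfolding product_parts_def using 0 cap_squarefree
    by (intro CollectI exI[of _ "[f]"] exI[of _ \<alpha>]) auto
  then show ?case by (simp add: sums_of_product_partsI)
next
  case (Suc p)
  note IH = Suc.IH
  from Suc.prems show ?case
  proof (induction "nat (sum \<alpha> UNIV)" arbitrary: f \<alpha> rule: less_induct)
    case less
    note f = less.prems(1) and \<alpha> = less.prems(2)
    show ?case
    proof (cases "f = 0")
      case False
      obtain g e where g: "g \<in> comp 1 (mdegree_of_exp e)" "\<delta> g = scale (monom e) one"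
        and e: "\<And>v. mdegree_of_exp e v \<le> \<alpha> v"
        using generator_below[OF f False] by blast
      define h where "h = sqf_part (mult g f)"
      have h: "h \<in> comp (Suc (Suc (Suc p))) \<alpha>"
        unfolding h_def by (rule sqf_part_homotopy(2)[OF f \<alpha> g e])
      obtain u where u: "\<And>v. u v \<in> comp (Suc (Suc p)) (lower v \<alpha>)"
        "\<delta> h = (\<Sum>v\<in>UNIV. scale (var v) (u v))"
        using irrelevant_multiples_hom[OF \<delta>_in_comp[OF h] range_\<delta>_irrelevant] by blast
      have "scale (var v) (u v) \<in> sums_of_product_parts (Suc (Suc p)) \<alpha>" for v
      proof (cases "u v = 0")
        case False
        have pos: "0 \<le> lower v \<alpha> w" for w by (rule comp_nonneg[OF u(1) False])
        \<comment> \<open>A nonzero \<open>u v\<close> has a nonnegative degree, so \<open>v\<close> is in the support of \<open>\<alpha>\<close>.\<close>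
        have v: "\<alpha> v = 1"
          using pos[of v] \<alpha> unfolding lower_def squarefree_mdegree_def
          by (metis antisym diff_ge_0_iff_ge fun_upd_same)
        have sqf: "squarefree_mdegree (lower v \<alpha>)"
          using \<alpha> v by (auto simp: squarefree_mdegree_def lower_def)
        have "nat (sum (lower v \<alpha>) UNIV) < nat (sum \<alpha> UNIV)"
          using sum_nonneg[of UNIV "lower v \<alpha>"] pos by (simp add: sum_lower)
        then have "u v \<in> sums_of_product_parts (Suc (Suc p)) (lower v \<alpha>)"
          by (rule less.hyps) (rule u(1), rule sqf)
        then show ?thesis using v by (rule sums_of_product_parts_var)
      qed (simp add: sums_of_product_parts_0)
      then have "\<delta> h \<in> sums_of_product_parts (Suc (Suc p)) \<alpha>"
        unfolding u(2) by (rule sums_of_product_parts_sum)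
      moreover have "sqf_part (mult g (\<delta> f)) \<in> sums_of_product_parts (Suc (Suc p)) \<alpha>"
        by (rule sums_of_product_parts_mult[OF IH[OF \<delta>_in_comp[OF f] \<alpha>] g(1) e \<alpha>])
      moreover have "f = \<delta> h + sqf_part (mult g (\<delta> f))"
        unfolding h_def by (rule sqf_part_homotopy(1)[OF f \<alpha> g e])
      ultimately show ?thesis using sums_of_product_parts_add by metis
    qed (simp add: sums_of_product_parts_0)
  qed
qed

lemma sums_of_product_partsE:
  assumes "f \<in> sums_of_product_parts p \<alpha>"
  obtains N :: nat and g :: "nat \<Rightarrow> nat \<Rightarrow> 'm"
  where "\<forall>l\<in>{1..p}. \<forall>j<N. \<exists>\<beta>. g l j \<in> comp 1 \<beta>"
    "f = (\<Sum>j<N. sqf_part (right_nested mult (map (\<lambda>l. g l j) [1..<Suc p])))"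
proof -
  obtain zs where zs: "f = sum_list zs" "set zs \<subseteq> product_parts p \<alpha>"
    using assms unfolding sums_of_product_parts_def by blast
  have "\<forall>j. \<exists>gs. j < length zs \<longrightarrow> zs ! j = sqf_part (right_nested mult gs) \<and>
      length gs = p \<and> set gs \<subseteq> (\<Union>\<beta>. comp 1 \<beta>)"
  proof
    fix j
    have "j < length zs \<Longrightarrow> zs ! j \<in> product_parts p \<alpha>" using nth_mem zs(2) by blast
    then show "\<exists>gs. j < length zs \<longrightarrow> zs ! j = sqf_part (right_nested mult gs) \<and>
        length gs = p \<and> set gs \<subseteq> (\<Union>\<beta>. comp 1 \<beta>)"
      unfolding product_parts_def by auto
  qed
  from choice[OF this] obtain gs where gs0:
    "\<forall>j. j < length zs \<longrightarrow> zs ! j = sqf_part (right_nested mult (gs j)) \<and>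
      length (gs j) = p \<and> set (gs j) \<subseteq> (\<Union>\<beta>. comp 1 \<beta>)"
    by (rule exE)
  have gs: "zs ! j = sqf_part (right_nested mult (gs j))" "length (gs j) = p"
    "set (gs j) \<subseteq> (\<Union>\<beta>. comp 1 \<beta>)" if "j < length zs" for j
    using gs0[rule_format, OF that] by simp_all
  have map: "map (\<lambda>l. gs j ! (l - 1)) [1..<Suc p] = gs j" if "j < length zs" for j
    using gs(2)[OF that] by (intro nth_equalityI) (simp_all del: upt_Suc)
  show thesis
  proof (rule that[of "length zs" "\<lambda>l j. gs j ! (l - 1)"]; (intro ballI allI impI)?)
    fix l j assume lj: "l \<in> {1..p}" "j < length zs"
    have "gs j ! (l - 1) \<in> set (gs j)" using lj(1) gs(2)[OF lj(2)] by (intro nth_mem) auto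
    then show "\<exists>\<beta>. gs j ! (l - 1) \<in> comp 1 \<beta>" using gs(3)[OF lj(2)] by blast
  next
    show "f = (\<Sum>j<length zs. sqf_part (right_nested mult (map (\<lambda>l. gs j ! (l - 1)) [1..<Suc p])))"
      unfolding zs(1) sum_list_sum_nth atLeast0LessThan
      by (intro sum.cong[OF refl]) (simp only: lessThan_iff map gs(1))
  qed
qed

end

theorem proposition3p4:
  fixes scale :: "('n::finite, 'k::field) mpoly \<Rightarrow> 'm::ab_group_add \<Rightarrow> 'm"
    and comp :: "nat \<Rightarrow> 'n mdegree \<Rightarrow> 'm set"
    and \<delta> :: "'m \<Rightarrow> 'm"
    and one :: 'm
    and I :: "('n, 'k) mpoly set"
    and mult :: "'m \<Rightarrow> 'm \<Rightarrow> 'm"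
    and f :: 'm
    and p :: nat
    and \<alpha> :: "'n mdegree"
  assumes "squarefree_monomial_ideal I"
    and "I \<noteq> UNIV"
    and "minimal_free_resolution scale comp \<delta> one I"
    and "resolution_multiplication scale comp \<delta> one I mult"
    and "f \<in> comp p \<alpha>"
    and "p \<ge> 1"
    and "squarefree_mdegree \<alpha>"
  shows "\<exists>(N::nat) (g :: nat \<Rightarrow> nat \<Rightarrow> 'm).
    (\<forall>l\<in>{1..p}. \<forall>j<N. \<exists>\<beta>. g l j \<in> comp 1 \<beta>) \<and>
    f = (\<Sum>j<N. multigraded_module.sqf_part scale comp
                  (right_nested mult (map (\<lambda>l. g l j) [1..<Suc p])))"
proof -
  interpret resolution_multiplication scale comp \<delta> one I mult by (rule assms(4))
  interpret squarefree_resolution_multiplication scale comp \<delta> one I mult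
    by unfold_locales (rule assms(1))
  have "f \<in> sums_of_product_parts p \<alpha>"
    using comp_subset_sums_of_product_parts[of f "p - 1" \<alpha>] assms by simp
  then obtain N :: nat and g :: "nat \<Rightarrow> nat \<Rightarrow> 'm" where
    "\<forall>l\<in>{1..p}. \<forall>j<N. \<exists>\<beta>. g l j \<in> comp 1 \<beta>"
    "f = (\<Sum>j<N. sqf_part (right_nested mult (map (\<lambda>l. g l j) [1..<Suc p])))"
    by (rule sums_of_product_partsE)
  then show ?thesis by (intro exI[of _ N] exI[of _ g] conjI)
qed

end
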